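(* Let $N\ge2$ and let $(\theta_t)_{t\ge0}$ be a trajectory of the ACCA dynamics on the ring, with first singular time $\tau$, winding number $W_0$ of $\theta_0$, and $\beta=\frac{2\pi W_0}{N}$. Let $(\eta_t)$ be its lifted representation (from some initial lift $\eta_0$ of $\theta_0$), $(s_t)$ the compensator and $(\zeta_t)$ the detrended process. Let $t<\tau$ and suppose that the edge $(k_t,k_t+1)$ is updated at time $t$. Then \[ \zeta_{t+1}(k_t)=\zeta_{t+1}(k_t+1)=\frac{\zeta_t(k_t)+\zeta_t(k_t+1)}{2}, \] while all other coordinates remain unchanged. (Here the coordinates of $\zeta$ are indexed by the vertices of the ring, the indices $1$ and $N+1$ being identified via $\zeta_t(N+1)=\zeta_t(1)$.) In particular, the $\zeta$-dynamics is an exact Euclidean midpoint update on the selected edge.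
   Context: For $a\in\mathbb R$, $\operatorname{wrap}_\pi(a):=a-2\pi\lfloor\frac{a+\pi}{2\pi}\rfloor\in[-\pi,\pi)$. The ring has vertices $1,\dots,N$ and edges $(i,i+1)$, $1\le i\le N$; vertex indices of $\theta$, $\delta$, $S_\pm$ are read modulo $N$. For a configuration $\theta_t\in[-\pi,\pi)^N$: $\delta_t(i):=\operatorname{wrap}_\pi(\theta_t(i+1)-\theta_t(i))$, $1\le i\le N$; $W_t:=\frac1{2\pi}\sum_{i=1}^N\delta_t(i)\in\mathbb Z$; $S^{(t)}_\pm(k):=\delta_t(k\pm1)+\frac12\delta_t(k)$. ACCA dynamics: at each step $t$ an edge $(k_t,k_t+1)$ is chosen uniformly at random among the $N$ edges, independently of the past; with $k=k_t$, $\theta_{t+1}(k)=\operatorname{wrap}_\pi(\theta_t(k)+\frac12\delta_t(k))$, $\theta_{t+1}(k+1)=\operatorname{wrap}_\pi(\theta_t(k+1)-\frac12\delta_t(k))$ (these coincide), and all other values are unchanged. (If $\delta_t(k)=-\pi$, the common new value is chosen with probability $1/2$ each between $\operatorname{wrap}_\pi(\theta_t(k)\pm\frac\pi2)$.) First singular time: $\tau:=\inf\{t\ge0:\ \exists k,\ S^{(t)}_-(k)\notin(-\pi,\pi)\text{ or }S^{(t)}_+(k)\notin(-\pi,\pi)\text{ or }\delta_t(k)=-\pi\}\in\mathbb N_0\cup\{\infty\}$. For all $t\le\tau$ one has $W_t=W_0$. Lift: a lift of $\theta\in[-\pi,\pi)^N$ is a vector $\eta\in\mathbb R^{N+1}$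 with $\eta(i+1)-\eta(i)=\delta(i)$ for $1\le i\le N$ and $\operatorname{wrap}_\pi(\eta(1))=\theta(1)$. Lifted representation: given an initial lift $\eta_0$ of $\theta_0$, for $t<\tau$ define $\eta_{t+1}\in\mathbb R^{N+1}$ by $\eta_{t+1}(k_t)=\eta_{t+1}(k_t+1):=\frac{\eta_t(k_t)+\eta_t(k_t+1)}2$ (for $k_t=N$ the index $k_t+1$ is $N+1$, not $1$) and by the increment relations $\eta_{t+1}(i+1)-\eta_{t+1}(i)=\delta_{t+1}(i)$, $1\le i\le N$. Compensator: $s_0\equiv0\in\mathbb R^N$; when edge $(k,k+1)$ is updated at time $t$ (with $k+1$ read as $1$ if $k=N$), $s_{t+1}(k)=\frac{s_t(k)+s_t(k+1)}2+\frac\beta2$, $s_{t+1}(k+1)=\frac{s_t(k)+s_t(k+1)}2-\frac\beta2$, and $s_{t+1}(i)=s_t(i)$ otherwise; set $s_t(N+1):=s_t(1)$. Detrended process: $\zeta_t(i):=\eta_t(i)-\beta(i-1)-s_t(i)$, $1\le i\le N+1$. It satisfies $\zeta_t(N+1)=\zeta_t(1)$. *)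

theory Defs
  imports "HOL-Probability.Probability_Mass_Function" "HOL-Library.Extended_Nat"
begin

definition wrap_pi :: "real \<Rightarrow> real" where
  "wrap_pi a = a - 2 * pi * of_int \<lfloor>(a + pi) / (2 * pi)\<rfloor>"

(* The representative in {1..N} of i modulo N; in particular 0 is sent to N and N + 1 to 1. *)
definition ring_index :: "nat \<Rightarrow> nat \<Rightarrow> nat" where
  "ring_index N i = (if i mod N = 0 then N else i mod N)"

(* Extensional functions, so that a configuration carries no data off the vertices 1, ..., N. *)
definition configs :: "nat \<Rightarrow> (nat \<Rightarrow> real) set" where
  "configs N = {1..N} \<rightarrow>\<^sub>E {-pi..<pi}"

definition delta :: "nat \<Rightarrow> (nat \<Rightarrow> real) \<Rightarrow> nat \<Rightarrow> real" where
  "delta N \<theta> i = wrap_pi (\<theta> (ring_index N (i + 1)) - \<theta> (ring_index N i))"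

definition winding :: "nat \<Rightarrow> (nat \<Rightarrow> real) \<Rightarrow> real" where
  "winding N \<theta> = (\<Sum>i=1..N. delta N \<theta> i) / (2 * pi)"

(* The truncated subtraction is harmless: edges are numbered from 1. *)
definition S_minus :: "nat \<Rightarrow> (nat \<Rightarrow> real) \<Rightarrow> nat \<Rightarrow> real" where
  "S_minus N \<theta> k = delta N \<theta> (k - 1) + delta N \<theta> k / 2"

definition S_plus :: "nat \<Rightarrow> (nat \<Rightarrow> real) \<Rightarrow> nat \<Rightarrow> real" where
  "S_plus N \<theta> k = delta N \<theta> (k + 1) + delta N \<theta> k / 2"

definition edge_update :: "nat \<Rightarrow> (nat \<Rightarrow> real) \<Rightarrow> nat \<Rightarrow> (nat \<Rightarrow> real) pmf" where
  "edge_update N \<theta> k =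
     (let j = ring_index N (k + 1) in
      if delta N \<theta> k = - pi
      then map_pmf (\<lambda>b. let v = (if b then wrap_pi (\<theta> k + pi / 2) else wrap_pi (\<theta> k - pi / 2))
                        in \<theta>(k := v, j := v))
             (bernoulli_pmf (1 / 2))
      else return_pmf (\<theta>(k := wrap_pi (\<theta> k + delta N \<theta> k / 2),
                         j := wrap_pi (\<theta> j - delta N \<theta> k / 2))))"

(* The one-step Markov kernel, recording the chosen edge along with the new configuration. *)
definition acca_step :: "nat \<Rightarrow> (nat \<Rightarrow> real) \<Rightarrow> (nat \<times> (nat \<Rightarrow> real)) pmf" where
  "acca_step N \<theta> = bind_pmf (pmf_of_set {1..N}) (\<lambda>k. map_pmf (Pair k) (edge_update N \<theta> k))"

(* A realization of the random dynamics: k t is the edge updated at time t,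
   and every transition has positive probability under the kernel. *)
definition acca_trajectory :: "nat \<Rightarrow> (nat \<Rightarrow> nat) \<Rightarrow> (nat \<Rightarrow> nat \<Rightarrow> real) \<Rightarrow> bool" where
  "acca_trajectory N k \<theta> \<longleftrightarrow>
     \<theta> 0 \<in> configs N \<and> (\<forall>t. (k t, \<theta> (t + 1)) \<in> set_pmf (acca_step N (\<theta> t)))"

definition singular :: "nat \<Rightarrow> (nat \<Rightarrow> real) \<Rightarrow> bool" where
  "singular N \<theta> \<longleftrightarrow>
     (\<exists>k\<in>{1..N}. S_minus N \<theta> k \<notin> {-pi<..<pi} \<or> S_plus N \<theta> k \<notin> {-pi<..<pi} \<or> delta N \<theta> k = - pi)"

(* The infimum of the empty set of extended naturals is \<infinity>. *)
definition first_singular_time :: "nat \<Rightarrow> (nat \<Rightarrow> nat \<Rightarrow> real) \<Rightarrow> enat" where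
  "first_singular_time N \<theta> = Inf {enat t | t. singular N (\<theta> t)}"

(* Vectors in R^(N+1) are functions of which only the values on {1..N+1} matter. *)
definition is_lift :: "nat \<Rightarrow> (nat \<Rightarrow> real) \<Rightarrow> (nat \<Rightarrow> real) \<Rightarrow> bool" where
  "is_lift N \<theta> \<eta> \<longleftrightarrow>
     (\<forall>i\<in>{1..N}. \<eta> (i + 1) - \<eta> i = delta N \<theta> i) \<and> wrap_pi (\<eta> 1) = \<theta> 1"

(* For k t = N the index k t + 1 is N + 1, so it is not reduced modulo N here.
   Values after the first singular time are unconstrained. *)
definition lifted_representation ::
    "nat \<Rightarrow> (nat \<Rightarrow> nat) \<Rightarrow> (nat \<Rightarrow> nat \<Rightarrow> real) \<Rightarrow> (nat \<Rightarrow> nat \<Rightarrow> real) \<Rightarrow> bool" where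
  "lifted_representation N k \<theta> \<eta> \<longleftrightarrow>
     is_lift N (\<theta> 0) (\<eta> 0) \<and>
     (\<forall>t. enat t < first_singular_time N \<theta> \<longrightarrow>
        \<eta> (t + 1) (k t) = (\<eta> t (k t) + \<eta> t (k t + 1)) / 2 \<and>
        \<eta> (t + 1) (k t + 1) = (\<eta> t (k t) + \<eta> t (k t + 1)) / 2 \<and>
        (\<forall>i\<in>{1..N}. \<eta> (t + 1) (i + 1) - \<eta> (t + 1) i = delta N (\<theta> (t + 1)) i))"

primrec compensator :: "nat \<Rightarrow> real \<Rightarrow> (nat \<Rightarrow> nat) \<Rightarrow> nat \<Rightarrow> nat \<Rightarrow> real" where
  "compensator N \<beta> k 0 = (\<lambda>i. 0)"
| "compensator N \<beta> k (Suc t) =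
     (let s = compensator N \<beta> k t; j = ring_index N (k t + 1)
      in s(k t := (s (k t) + s j) / 2 + \<beta> / 2, j := (s (k t) + s j) / 2 - \<beta> / 2))"

(* The ring index implements the convention s t (N + 1) = s t 1. *)
definition detrended ::
    "nat \<Rightarrow> real \<Rightarrow> (nat \<Rightarrow> nat) \<Rightarrow> (nat \<Rightarrow> nat \<Rightarrow> real) \<Rightarrow> nat \<Rightarrow> nat \<Rightarrow> real" where
  "detrended N \<beta> k \<eta> t i =
     \<eta> t i - \<beta> * (real i - 1) - compensator N \<beta> k t (ring_index N i)"

end

theory Submission
  imports Defs "HOL-Library.Real_Mod"
begin

text \<open>Away from the singular set, updating edge \<open>k\<close> at time \<open>t\<close> changes the increments by exactly
  \<open>\<delta> k / 2 * (b (i + 1) - b i)\<close>, where \<open>b\<close> is \<open>1\<close> at the vertex \<open>k\<close>, \<open>-1\<close> at the next vertex of the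
  ring and \<open>0\<close> elsewhere: this holds modulo \<open>2\<pi>\<close> in any case, and both sides lie in \<open>[-\<pi>, \<pi>)\<close>.
  Hence the winding number is conserved up to the first singular time, so that
  \<open>\<eta>\<^sub>t (N + 1) - \<eta>\<^sub>t 1 = \<beta> N\<close>, and the lift changes by \<open>\<delta> k / 2 * b i\<close> at every index,
  because two functions on \<open>{1..N+1}\<close> with the same increments and the same value at \<open>k\<close> agree.\<close>

section \<open>Wrapping of angles and ring indices\<close>

lemma wrap_pi_rcong: "[wrap_pi a = a] (rmod (2 * pi))"
  unfolding wrap_pi_def rcong_altdef
  by (rule exI[of _ "\<lfloor>(a + pi) / (2 * pi)\<rfloor>"]) (simp add: algebra_simps)

lemma wrap_pi_bounds: "- pi \<le> wrap_pi a" "wrap_pi a < pi"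
proof -
  have "of_int \<lfloor>(a + pi) / (2 * pi)\<rfloor> * (2 * pi) \<le> a + pi"
    by (rule floor_divide_lower) simp
  moreover have "a + pi < (of_int \<lfloor>(a + pi) / (2 * pi)\<rfloor> + 1) * (2 * pi)"
    by (rule floor_divide_upper) simp
  ultimately show "- pi \<le> wrap_pi a" "wrap_pi a < pi"
    by (simp_all add: wrap_pi_def algebra_simps)
qed

text \<open>Two congruent points of a half-open interval of length \<open>2 * pi\<close> coincide.
  This turns each identity between increments into a congruence plus a bound.\<close>

lemma wrap_pi_eqI:
  assumes "[a = b] (rmod (2 * pi))" and "- pi \<le> b" "b < pi"
  shows "wrap_pi a = b"
proof (rule rcong_imp_eq)
  show "[wrap_pi a = b] (rmod (2 * pi))"
    using wrap_pi_rcong assms(1) by (rule rcong_trans)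
  show "\<bar>wrap_pi a - b\<bar> < \<bar>2 * pi\<bar>"
    using wrap_pi_bounds[of a] assms(2,3) by linarith
qed

lemma ring_index_eq:
  assumes "i \<in> {1..N+1}"
  shows "ring_index N i = (if i = N + 1 then 1 else i)"
proof -
  \<comment> \<open>\<open>N = 0\<close> and \<open>N = 1\<close> are split off because there the
    remainder of \<open>N + 1\<close> follows \<open>1 mod 0 = 1\<close> and
    \<open>2 mod 1 = 0\<close>.\<close>
  consider "i < N" | "i = N" | "i = N + 1" "N = 0" | "i = N + 1" "N = 1" | "i = N + 1" "N > 1"
    using assms by (cases "i \<le> N") force+
  then show ?thesis
    by cases (use assms in \<open>auto simp: ring_index_def mod_Suc\<close>)
qed

lemma ring_index_0: "ring_index N 0 = N"
  by (simp add: ring_index_def)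

section \<open>A single edge update: angles, increments and winding number\<close>

definition update_sign :: "nat \<Rightarrow> nat \<Rightarrow> nat \<Rightarrow> real" where
  "update_sign N k i =
     of_bool (ring_index N i = k) - of_bool (ring_index N i = ring_index N (k + 1))"

lemma edge_update_rcong:
  assumes "N \<ge> 2" "k \<in> {1..N}" and "delta N \<theta> k \<noteq> - pi"
    and "\<theta>' \<in> set_pmf (edge_update N \<theta> k)"
  shows "[\<theta>' (ring_index N i) = \<theta> (ring_index N i) + delta N \<theta> k / 2 * update_sign N k i]
    (rmod (2 * pi))"
proof -
  have \<theta>': "\<theta>' = \<theta>(k := wrap_pi (\<theta> k + delta N \<theta> k / 2),
      ring_index N (k + 1) := wrap_pi (\<theta> (ring_index N (k + 1)) - delta N \<theta> k / 2))"
    using assms(3,4) by (simp add: edge_update_def Let_def)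
  \<comment> \<open>The endpoints are distinct, so the second function update does not overwrite the
    first.\<close>
  have "ring_index N (k + 1) \<noteq> k"
    using assms(1,2) by (auto simp: ring_index_eq)
  then show ?thesis
    using wrap_pi_rcong[of "\<theta> k + delta N \<theta> k / 2"]
      wrap_pi_rcong[of "\<theta> (ring_index N (k + 1)) - delta N \<theta> k / 2"]
    by (auto simp: \<theta>' update_sign_def)
qed

text \<open>The right-hand side is 0 on the updated edge and unchanged on distant edges. For
  \<open>N > 2\<close> it is \<open>S_minus\<close> on the preceding edge and \<open>S_plus\<close>
  on the following one, which regularity confines to the open interval from \<open>- pi\<close> to
  \<open>pi\<close>.\<close>

lemma edge_update_delta:
  assumes N: "N \<ge> 2" and k: "k \<in> {1..N}" and i: "i \<in> {1..N}"
    and reg: "\<not> singular N \<theta>"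
    and upd: "\<theta>' \<in> set_pmf (edge_update N \<theta> k)"
  shows "delta N \<theta>' i =
    delta N \<theta> i + delta N \<theta> k / 2 * (update_sign N k (i + 1) - update_sign N k i)"
    (is "_ = ?r")
proof -
  have nopi: "delta N \<theta> k \<noteq> - pi"
    using reg k by (auto simp: singular_def)
  have bnd: "- pi \<le> delta N \<theta> l" "delta N \<theta> l < pi" for l
    by (simp_all add: delta_def wrap_pi_bounds)
  have Sm: "- pi < S_minus N \<theta> l" "S_minus N \<theta> l < pi"
   and Sp: "- pi < S_plus N \<theta> l" "S_plus N \<theta> l < pi" if "l \<in> {1..N}" for l
    using reg that by (auto simp: singular_def)
  have "[\<theta>' (ring_index N (i + 1)) - \<theta>' (ring_index N i) =
      (\<theta> (ring_index N (i + 1)) + delta N \<theta> k / 2 * update_sign N k (i + 1))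
      - (\<theta> (ring_index N i) + delta N \<theta> k / 2 * update_sign N k i)] (rmod (2 * pi))"
    using edge_update_rcong[OF N k nopi upd] by (intro rcong_diff)
  also have "(\<theta> (ring_index N (i + 1)) + delta N \<theta> k / 2 * update_sign N k (i + 1))
      - (\<theta> (ring_index N i) + delta N \<theta> k / 2 * update_sign N k i)
    = (\<theta> (ring_index N (i + 1)) - \<theta> (ring_index N i))
      + delta N \<theta> k / 2 * (update_sign N k (i + 1) - update_sign N k i)"
    by (simp add: algebra_simps)
  also have "[\<dots> = ?r] (rmod (2 * pi))"
    unfolding delta_def[of N \<theta> i]
    by (intro rcong_add rcong_refl rcong_sym[OF wrap_pi_rcong])
  finally have cong: "[\<theta>' (ring_index N (i + 1)) - \<theta>' (ring_index N i) = ?r] (rmod (2 * pi))" .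
  \<comment> \<open>For \<open>k = 1\<close> the index \<open>k - 1\<close> is 0, which
    \<open>ring_index\<close> sends to \<open>N\<close>, so the edge read is again the preceding
    one.\<close>
  have delta_prev: "delta N \<theta> (k - 1) = delta N \<theta> i" if "ring_index N (i + 1) = k"
    using that i k by (auto simp: delta_def ring_index_eq ring_index_0 split: if_splits)
  have delta_next: "delta N \<theta> (k + 1) = delta N \<theta> i" if "ring_index N (k + 1) = i"
  proof (cases "k = N")
    case True
    then have "i = 1" using that N by (simp add: ring_index_eq)
    \<comment> \<open>The edge index \<open>N + 1\<close> makes \<open>delta\<close> read vertex
      \<open>N + 2\<close>, outside the range of \<open>ring_index_eq\<close>.\<close>
    moreover have "ring_index N (N + 2) = ring_index N 2"
      unfolding ring_index_def mod_add_self1 ..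
    ultimately show ?thesis using True N by (simp add: delta_def ring_index_eq numeral_2_eq_2)
  next
    case False
    then show ?thesis using that k by (simp add: ring_index_eq)
  qed
  have rk: "ring_index N k = k" "ring_index N i = i"
    using k i by (simp_all add: ring_index_eq)
  have "- pi \<le> ?r \<and> ?r < pi"
  proof (cases "i = k")
    case True
    moreover have "ring_index N (k + 1) \<noteq> k"
      using N k by (auto simp: ring_index_eq)
    ultimately show ?thesis by (simp add: update_sign_def rk)
  next
    case ik: False
    \<comment> \<open>Distinct edges have distinct right endpoints, so the negative term of
      \<open>update_sign N k (i + 1)\<close> vanishes.\<close>
    have inj: "ring_index N (i + 1) \<noteq> ring_index N (k + 1)"
      using ik i k by (auto simp: ring_index_eq)
    consider (both) "ring_index N (i + 1) = k" "ring_index N (k + 1) = i"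
      | (prev) "ring_index N (i + 1) = k" "ring_index N (k + 1) \<noteq> i"
      | (nxt) "ring_index N (i + 1) \<noteq> k" "ring_index N (k + 1) = i"
      | (far) "ring_index N (i + 1) \<noteq> k" "ring_index N (k + 1) \<noteq> i"
      by blast
    then show ?thesis
    proof cases
      case both
        \<comment> \<open>Only for \<open>N = 2\<close>: then \<open>?r\<close> is the sum of both increments, a multiple of \<open>2\<pi>\<close>,
          and it vanishes since the bound on \<open>S_minus\<close> makes it smaller than \<open>2\<pi>\<close>.\<close>
      have r: "?r = delta N \<theta> i + delta N \<theta> k"
        using both ik inj by (simp add: update_sign_def rk)
      have "[delta N \<theta> i + delta N \<theta> k = (\<theta> k - \<theta> i) + (\<theta> i - \<theta> k)] (rmod (2 * pi))"
        unfolding delta_def both rk by (intro rcong_add wrap_pi_rcong)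
      moreover have "\<bar>delta N \<theta> i + delta N \<theta> k\<bar> < 2 * pi"
      proof -
        have "S_minus N \<theta> k = delta N \<theta> i + delta N \<theta> k / 2"
          by (simp only: S_minus_def delta_prev[OF both(1)])
        then show ?thesis
          using Sm[OF k] bnd[of k] by linarith
      qed
      ultimately have "delta N \<theta> i + delta N \<theta> k = 0"
        by (intro rcong_imp_eq[of _ _ "2 * pi"]) simp_all
      then show ?thesis unfolding r by simp
    next
      case prev
      then have "?r = S_minus N \<theta> k"
        unfolding S_minus_def delta_prev[OF prev(1)] using ik inj by (auto simp: update_sign_def rk)
      then show ?thesis using Sm[OF k] by simp
    next
      case nxt
      then have "?r = S_plus N \<theta> k"
        unfolding S_plus_def delta_next[OF nxt(2)] using ik inj by (auto simp: update_sign_def rk)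
      then show ?thesis using Sp[OF k] by simp
    next
      case far
      then have r: "?r = delta N \<theta> i"
        using ik inj by (auto simp: update_sign_def rk)
      show ?thesis unfolding r using bnd by simp
    qed
  qed
  then show ?thesis
    unfolding delta_def[of N \<theta>' i] using cong by (intro wrap_pi_eqI) auto
qed

text \<open>The corrections telescope around the ring, and \<open>update_sign\<close> agrees at 1
  and \<open>N + 1\<close> because it reads its argument through \<open>ring_index\<close>.\<close>

lemma edge_update_winding:
  assumes "N \<ge> 2" "k \<in> {1..N}" "\<not> singular N \<theta>" "\<theta>' \<in> set_pmf (edge_update N \<theta> k)"
  shows "winding N \<theta>' = winding N \<theta>"
proof -
  have "(\<Sum>i=1..N. update_sign N k (i + 1) - update_sign N k i)
      = update_sign N k (N + 1) - update_sign N k 1"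
    using sum_Suc_diff[of 1 N "update_sign N k"] by simp
  also have "\<dots> = 0"
    using assms(1) by (simp add: update_sign_def ring_index_eq)
  finally have "(\<Sum>i=1..N. delta N \<theta> k / 2 * (update_sign N k (i + 1) - update_sign N k i)) = 0"
    unfolding sum_distrib_left[symmetric] by simp
  moreover have "(\<Sum>i=1..N. delta N \<theta>' i) = (\<Sum>i=1..N. delta N \<theta> i
      + delta N \<theta> k / 2 * (update_sign N k (i + 1) - update_sign N k i))"
    using assms by (intro sum.cong refl edge_update_delta)
  ultimately show ?thesis
    by (simp add: winding_def sum.distrib)
qed

section \<open>Trajectories and lifts up to the first singular time\<close>

lemma acca_trajectory_step:
  assumes "acca_trajectory N k \<theta>" "N \<ge> 2"
  shows "k t \<in> {1..N}" "\<theta> (t + 1) \<in> set_pmf (edge_update N (\<theta> t) (k t))"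
  using assms unfolding acca_trajectory_def acca_step_def by fastforce+

lemma not_singular_before:
  assumes "enat t < first_singular_time N \<theta>"
  shows "\<not> singular N (\<theta> t)"
proof
  assume "singular N (\<theta> t)"
  then have "first_singular_time N \<theta> \<le> enat t"
    unfolding first_singular_time_def by (intro Inf_lower) blast
  with assms show False by simp
qed

text \<open>Only the configurations before \<open>t\<close> must be regular, so \<open>t\<close> may
  equal the first singular time. This covers time \<open>t + 1\<close> after a step made strictly
  before it.\<close>

lemma winding_conserved:
  assumes "N \<ge> 2" "acca_trajectory N k \<theta>" "enat t \<le> first_singular_time N \<theta>"
  shows "winding N (\<theta> t) = winding N (\<theta> 0)"
  using assms(3)
proof (induction t)
  case (Suc t)
  then have lt: "enat t < first_singular_time N \<theta>"
    using Suc_ile_eq by blast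
  have "winding N (\<theta> (t + 1)) = winding N (\<theta> t)"
    using assms(1) acca_trajectory_step[OF assms(2,1)] not_singular_before[OF lt]
    by (intro edge_update_winding)
  with Suc.IH lt show ?case by simp
qed simp

lemma lifted_representation_increment:
  assumes "lifted_representation N k \<theta> \<eta>" "enat t \<le> first_singular_time N \<theta>" "i \<in> {1..N}"
  shows "\<eta> t (i + 1) - \<eta> t i = delta N (\<theta> t) i"
proof (cases t)
  case 0
  then show ?thesis using assms by (auto simp: lifted_representation_def is_lift_def)
next
  case (Suc u)
  then have "enat u < first_singular_time N \<theta>"
    using assms(2) Suc_ile_eq by blast
  then show ?thesis
    using assms(1,3) Suc by (auto simp: lifted_representation_def)
qed

lemma lifted_representation_period:
  assumes "N \<ge> 2" "acca_trajectory N k \<theta>" "lifted_representation N k \<theta> \<eta>"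
    and "enat t \<le> first_singular_time N \<theta>"
  shows "\<eta> t (N + 1) - \<eta> t 1 = 2 * pi * winding N (\<theta> 0)"
proof -
  have "\<eta> t (N + 1) - \<eta> t 1 = (\<Sum>i=1..N. \<eta> t (i + 1) - \<eta> t i)"
    using sum_Suc_diff[of 1 N "\<eta> t"] by simp
  also have "\<dots> = (\<Sum>i=1..N. delta N (\<theta> t) i)"
    using lifted_representation_increment[OF assms(3,4)] by (intro sum.cong) auto
  also have "\<dots> = 2 * pi * winding N (\<theta> t)"
    by (simp add: winding_def)
  finally show ?thesis
    using winding_conserved[OF assms(1,2,4)] by simp
qed

lemma eq_on_interval_if_same_increments:
  fixes f g :: "nat \<Rightarrow> real"
  assumes "\<And>i. i \<in> {1..N} \<Longrightarrow> f (i + 1) - f i = g (i + 1) - g i"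
    and "k \<in> {1..N+1}" "f k = g k" and "i \<in> {1..N+1}"
  shows "f i = g i"
proof -
  have "f j - g j = f 1 - g 1" if "1 \<le> j" "j \<le> N + 1" for j
    using that
  proof (induction j rule: dec_induct)
    case (step j)
    then show ?case using assms(1)[of j] by simp
  qed simp
  from this[of k] this[of i] show ?thesis
    using assms(2-4) by simp
qed

text \<open>As \<open>update_sign\<close> is periodic in its index, an update of edge
  \<open>N\<close> also shifts coordinate 1, and an update of edge 1 also shifts coordinate
  \<open>N + 1\<close>.\<close>

lemma lifted_representation_step:
  assumes "N \<ge> 2" "acca_trajectory N k \<theta>" "lifted_representation N k \<theta> \<eta>"
    and lt: "enat t < first_singular_time N \<theta>" and i: "i \<in> {1..N+1}"
  shows "\<eta> (t + 1) i = \<eta> t i + delta N (\<theta> t) (k t) / 2 * update_sign N (k t) i"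
proof (rule eq_on_interval_if_same_increments[where k = "k t" and N = N])
  note k = acca_trajectory_step(1)[OF assms(2,1), of t]
  have le: "enat t \<le> first_singular_time N \<theta>" "enat (t + 1) \<le> first_singular_time N \<theta>"
    using lt by (simp_all add: Suc_ile_eq)
  fix j assume j: "j \<in> {1..N}"
  show "\<eta> (t + 1) (j + 1) - \<eta> (t + 1) j =
    (\<eta> t (j + 1) + delta N (\<theta> t) (k t) / 2 * update_sign N (k t) (j + 1))
    - (\<eta> t j + delta N (\<theta> t) (k t) / 2 * update_sign N (k t) j)"
    using lifted_representation_increment[OF assms(3) le(1) j]
      lifted_representation_increment[OF assms(3) le(2) j]
      edge_update_delta[OF assms(1) k j not_singular_before[OF lt]
        acca_trajectory_step(2)[OF assms(2,1)]]
    by (simp add: algebra_simps)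
next
  note k = acca_trajectory_step(1)[OF assms(2,1), of t]
  then show "k t \<in> {1..N+1}" by simp
  \<comment> \<open>Anchor of the comparison: the midpoint is the left end value plus half the
    increment.\<close>
  have "update_sign N (k t) (k t) = 1"
    using k assms(1) by (auto simp: update_sign_def ring_index_eq)
  moreover have "\<eta> t (k t + 1) - \<eta> t (k t) = delta N (\<theta> t) (k t)"
    using lifted_representation_increment[OF assms(3) _ k] lt by simp
  moreover have "\<eta> (t + 1) (k t) = (\<eta> t (k t) + \<eta> t (k t + 1)) / 2"
    using assms(3) lt by (simp add: lifted_representation_def)
  ultimately show "\<eta> (t + 1) (k t) =
    \<eta> t (k t) + delta N (\<theta> t) (k t) / 2 * update_sign N (k t) (k t)"
    by (simp add: field_simps)
qed (rule i)

section \<open>The detrended process\<close>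

lemma detrended_periodic:
  assumes "N \<ge> 2" "acca_trajectory N k \<theta>" "\<beta> = 2 * pi * winding N (\<theta> 0) / real N"
    and "lifted_representation N k \<theta> \<eta>" "enat t \<le> first_singular_time N \<theta>"
  shows "detrended N \<beta> k \<eta> t (N + 1) = detrended N \<beta> k \<eta> t 1"
proof -
  \<comment> \<open>The trend gained over one turn equals the total increment of the lift; the
    compensator has the same value at both ends.\<close>
  have "\<beta> * real N = 2 * pi * winding N (\<theta> 0)"
    using assms(1,3) by simp
  then show ?thesis
    using lifted_representation_period[OF assms(1,2,4,5)] assms(1)
    by (simp add: detrended_def ring_index_eq)
qed

theorem lemma4p18:
  fixes N t :: nat
    and k :: "nat \<Rightarrow> nat"
    and \<theta> \<eta> \<zeta> :: "nat \<Rightarrow> nat \<Rightarrow> real"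
    and \<beta> :: real
  assumes "N \<ge> 2"
    and "acca_trajectory N k \<theta>"
    and "\<beta> = 2 * pi * winding N (\<theta> 0) / real N"
    and "lifted_representation N k \<theta> \<eta>"
    and "\<zeta> = detrended N \<beta> k \<eta>"
    and "enat t < first_singular_time N \<theta>"
  shows "\<zeta> t (N + 1) = \<zeta> t 1 \<and> \<zeta> (t + 1) (N + 1) = \<zeta> (t + 1) 1 \<and>
    \<zeta> (t + 1) (k t) = (\<zeta> t (k t) + \<zeta> t (k t + 1)) / 2 \<and>
    \<zeta> (t + 1) (k t + 1) = (\<zeta> t (k t) + \<zeta> t (k t + 1)) / 2 \<and>
    (\<forall>i\<in>{1..N+1}. ring_index N i \<noteq> k t \<and> ring_index N i \<noteq> ring_index N (k t + 1)
       \<longrightarrow> \<zeta> (t + 1) i = \<zeta> t i)"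
proof -
  note k = acca_trajectory_step(1)[OF assms(2,1), of t]
  let ?j = "ring_index N (k t + 1)"
  have j: "?j \<noteq> k t" and rk: "ring_index N (k t) = k t"
    using k assms(1) by (auto simp: ring_index_eq)
  have le: "enat t \<le> first_singular_time N \<theta>" "enat (t + 1) \<le> first_singular_time N \<theta>"
    using assms(6) by (simp_all add: Suc_ile_eq)
  have eta: "\<eta> (t + 1) (k t) = (\<eta> t (k t) + \<eta> t (k t + 1)) / 2"
    "\<eta> (t + 1) (k t + 1) = (\<eta> t (k t) + \<eta> t (k t + 1)) / 2"
    using assms(4,6) by (simp_all add: lifted_representation_def)
  \<comment> \<open>The trend at the two ends differs from its mean by \<beta>/2 with opposite
    signs, which the offsets of the compensator cancel.\<close>
  have "\<zeta> (t + 1) (k t) = (\<zeta> t (k t) + \<zeta> t (k t + 1)) / 2"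
    "\<zeta> (t + 1) (k t + 1) = (\<zeta> t (k t) + \<zeta> t (k t + 1)) / 2"
    using eta j rk by (simp_all add: assms(5) detrended_def Let_def field_simps)
  \<comment> \<open>Away from both endpoints \<open>update_sign\<close> is 0 and the compensator is
    not touched.\<close>
  moreover have "\<zeta> (t + 1) i = \<zeta> t i"
    if "i \<in> {1..N+1}" "ring_index N i \<noteq> k t" "ring_index N i \<noteq> ?j" for i
    using lifted_representation_step[OF assms(1,2,4,6) that(1)] that(2,3)
    by (simp add: assms(5) detrended_def Let_def update_sign_def)
  ultimately show ?thesis
    using detrended_periodic[OF assms(1-4) le(1)] detrended_periodic[OF assms(1-4) le(2)]
    unfolding assms(5) by blast
qed

end
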